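(* Let $\gamma=(\gamma_n)_{n\ge 1}$ be a sequence of complex numbers, and put \[ b_n:=\sum_{d\mid n}\gamma_d \qquad (n\ge 1), \] where the sum runs over the positive divisors $d$ of $n$. If both $\gamma$ and $b=(b_n)_{n\ge 1}$ are eventually linearly recurrent, then $\gamma$ is finitely supported, i.e. $\gamma_n=0$ for all but finitely many $n$.
   Context: A sequence $u=(u_n)$ of complex numbers (indexed by $n\ge 0$ or by $n\ge 1$) is called eventually linearly recurrent if there exist an integer $r\ge 1$, coefficients $c_1,\dots,c_r\in\mathbb{C}$ with $c_r\neq 0$, and an index $N$ such that $u_{n+r}=c_1u_{n+r-1}+\cdots+c_r u_n$ for all $n\ge N$. *)

theory Defs
  imports Complex_Main
begin

(* A sequence indexed by n >= 1 is represented by a total function on nat whose value at 0 is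
   irrelevant: the threshold N may always be enlarged, so no finite set of values of u matters. *)
definition eventually_linearly_recurrent :: "(nat \<Rightarrow> complex) \<Rightarrow> bool" where
  "eventually_linearly_recurrent u \<longleftrightarrow>
     (\<exists>(r::nat) (c :: nat \<Rightarrow> complex) (N::nat). r \<ge> 1 \<and> c r \<noteq> 0 \<and>
        (\<forall>n\<ge>N. u (n + r) = (\<Sum>j=1..r. c j * u (n + r - j))))"

end

theory Submission
  imports Defs "HOL-Computational_Algebra.Polynomial" "HOL-Number_Theory.Cong"
    "HOL-Library.FuncSet"
begin

text \<open>
  The idea is to compare the divisor sum at two kinds of integers that a periodic sequence cannot
  tell apart. Suppose first that \<open>\<gamma>\<close> and \<open>b\<close> are periodic from \<open>N\<close> on, with common period \<open>M\<close>.
  Fix \<open>n \<ge> 1\<close> and take two distinct primes \<open>p\<close> and \<open>q\<close> in the same residue class modulo \<open>M\<close>, both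
  larger than \<open>n\<close>, with \<open>p \<ge> N\<close>. Then \<open>npq\<close> and \<open>np\<^sup>2\<close> are congruent modulo \<open>M\<close>, so \<open>b\<close> takes
  the same value at both. The divisors \<open>d\<close> and \<open>dp\<close> with \<open>d\<close> dividing \<open>n\<close> contribute equally
  to the two values, and so do \<open>dpq\<close> and \<open>dp\<^sup>2\<close>, by periodicity of \<open>\<gamma>\<close>. What remains is that the
  sum of \<open>\<gamma>(dq)\<close> over the divisors \<open>d\<close> of \<open>n\<close> is \<open>0\<close>. By induction on \<open>n\<close> this gives
  \<open>\<gamma>(nq) = 0\<close> for every \<open>n \<ge> 1\<close> and every prime \<open>q > n\<close> of the class. The class may be chosen
  prime to \<open>M\<close>, and then the products \<open>nq\<close> meet every residue class modulo \<open>M\<close>, so \<open>\<gamma>\<close> vanishes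
  from \<open>N\<close> on. This is \<open>periodic_divisor_sum_vanishes\<close>; the pigeonhole principle supplies the class.

  A linearly recurrent sequence of complex numbers is of course not periodic, but it becomes
  periodic in any finite ring in which the last coefficient of the recurrence is a unit, and
  periodic from the very index at which the recurrence starts
  (\<open>recurrence_periodic_mod_ideal\<close>). All terms of \<open>\<gamma>\<close> and \<open>b\<close> with positive index lie in a
  finitely generated subring \<open>A\<close> of the complex numbers. If \<open>\<gamma>(m) \<noteq> 0\<close> for some \<open>m\<close> beyond that
  index, choose an ideal \<open>I\<close> of \<open>A\<close> with finite nonzero quotient modulo which \<open>\<gamma>(m)\<close> and the
  last coefficients of both recurrences are units. The argument above, carried out modulo \<open>I\<close>,
  yields \<open>\<gamma>(m) \<in> I\<close>, which is impossible.

  The ideal \<open>I\<close> exists by an arithmetic form of the Nullstellensatz: every nonzero element of a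
  finitely generated domain of characteristic \<open>0\<close> is a unit in some finite nonzero quotient
  (\<open>finite_set_in_detected_ring\<close>). It is proved by adjoining one generator \<open>t\<close> at a time to the
  integers. Asking for a unit in the quotient, rather than for a prime ideal that omits the
  element, keeps every ideal explicit: if \<open>t\<close> is transcendental, adjoin the generator \<open>1 + ty\<close> to
  the extended ideal, and if \<open>t\<close> is algebraic, extend a suitable ideal of the base ring.
\<close>

section \<open>Subrings, ideals, and polynomials with restricted coefficients\<close>

text \<open>
  A subring \<open>A\<close> of the ambient domain together with an ideal \<open>I\<close> of \<open>A\<close>. The bare subring is the
  case \<open>I = A\<close>, so that every closure property of ideals is also one of subrings. The quotient of
  \<open>A\<close> by \<open>I\<close> is never formed; equality in it is written \<open>x - y \<in> I\<close>.
\<close>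
locale subring_ideal =
  fixes A I :: "'a::idom set"
  assumes one_mem: "1 \<in> A"
    and diff_mem: "x \<in> A \<Longrightarrow> y \<in> A \<Longrightarrow> x - y \<in> A"
    and mult_mem: "x \<in> A \<Longrightarrow> y \<in> A \<Longrightarrow> x * y \<in> A"
    and ideal_subset: "I \<subseteq> A"
    and zero_ideal: "0 \<in> I"
    and diff_ideal: "x \<in> I \<Longrightarrow> y \<in> I \<Longrightarrow> x - y \<in> I"
    and absorb: "a \<in> A \<Longrightarrow> x \<in> I \<Longrightarrow> a * x \<in> I"
begin

lemma absorb_right: "x \<in> I \<Longrightarrow> a \<in> A \<Longrightarrow> x * a \<in> I"
  by (metis absorb mult.commute)

lemma add_ideal: "x \<in> I \<Longrightarrow> y \<in> I \<Longrightarrow> x + y \<in> I"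
  using diff_ideal[of x "0 - y"] diff_ideal[of 0 y] zero_ideal by simp

lemma minus_commute_ideal: "x - y \<in> I \<longleftrightarrow> y - x \<in> I"
  using diff_ideal[of 0 "x - y"] diff_ideal[of 0 "y - x"] zero_ideal by auto

lemma sum_ideal: "(\<And>x. x \<in> X \<Longrightarrow> f x \<in> I) \<Longrightarrow> sum f X \<in> I"
  by (induction X rule: infinite_finite_induct) (auto simp: zero_ideal add_ideal)

lemma whole_ring: "subring_ideal A A"
proof
  show "0 \<in> A" using diff_mem[OF one_mem one_mem] by simp
qed (auto simp: one_mem diff_mem mult_mem)

lemma zero_mem: "0 \<in> A"
  by (rule subring_ideal.zero_ideal[OF whole_ring])

lemmas sum_mem = subring_ideal.sum_ideal[OF whole_ring]

lemma power_mem: "x \<in> A \<Longrightarrow> x ^ n \<in> A"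
  by (induction n) (auto simp: one_mem mult_mem)

lemma unit_power:
  assumes "x \<in> A" "z \<in> A" "x * z - 1 \<in> I"
  shows "(x * z) ^ n - 1 \<in> I"
proof (induction n)
  case (Suc n)
  have "(x * z) * ((x * z) ^ n - 1) + (x * z - 1) \<in> I"
    using assms Suc by (intro add_ideal absorb mult_mem)
  then show ?case by (simp add: algebra_simps)
qed (simp add: zero_ideal)

lemma cancel_unit:
  assumes "z \<in> A" "x * z - 1 \<in> I" "y \<in> A" "x * y \<in> I"
  shows "y \<in> I"
proof -
  have "z * (x * y) - y * (x * z - 1) \<in> I"
    by (rule diff_ideal[OF absorb[OF assms(1,4)] absorb[OF assms(3,2)]])
  then show ?thesis by (simp add: algebra_simps)
qed

lemma cancel_unit_power:
  assumes "x \<in> A" "z \<in> A" "x * z - 1 \<in> I" "x ^ n \<in> I"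
  shows "1 \<in> I"
proof -
  have "z ^ n * x ^ n - ((x * z) ^ n - 1) \<in> I"
    by (rule diff_ideal[OF absorb[OF power_mem[OF assms(2)] assms(4)] unit_power[OF assms(1-3)]])
  then show ?thesis by (simp add: power_mult_distrib mult.commute)
qed

end

definition polys_over :: "'a::zero set \<Rightarrow> 'a poly set" where
  "polys_over I = {p. \<forall>i. coeff p i \<in> I}"

context subring_ideal
begin

lemma polys_zero: "0 \<in> polys_over I"
  by (simp add: polys_over_def zero_ideal)

lemma polys_diff: "p \<in> polys_over I \<Longrightarrow> q \<in> polys_over I \<Longrightarrow> p - q \<in> polys_over I"
  by (simp add: polys_over_def diff_ideal)

lemma polys_add: "p \<in> polys_over I \<Longrightarrow> q \<in> polys_over I \<Longrightarrow> p + q \<in> polys_over I"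
  by (simp add: polys_over_def add_ideal)

lemma polys_smult: "a \<in> A \<Longrightarrow> p \<in> polys_over I \<Longrightarrow> smult a p \<in> polys_over I"
  by (simp add: polys_over_def absorb)

lemma polys_monom: "a \<in> I \<Longrightarrow> monom a n \<in> polys_over I"
  by (simp add: polys_over_def zero_ideal)

lemma polys_mult: "p \<in> polys_over A \<Longrightarrow> q \<in> polys_over I \<Longrightarrow> p * q \<in> polys_over I"
  by (auto simp: polys_over_def coeff_mult intro!: sum_ideal absorb)

lemma polys_mult_right: "p \<in> polys_over I \<Longrightarrow> q \<in> polys_over A \<Longrightarrow> p * q \<in> polys_over I"
  using polys_mult[of q p] by (simp add: mult.commute)

lemma polys_over_mono: "polys_over I \<subseteq> polys_over A"
  using ideal_subset by (auto simp: polys_over_def)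

text \<open>
  Division with remainder over a ring that need not contain the inverse of the leading coefficient:
  a power of that coefficient is multiplied in, once for each step of the division. Each step only
  multiplies coefficients of \<open>p\<close> by elements of \<open>A\<close>, so if those of \<open>p\<close> lie in \<open>I\<close>, then so do
  those of quotient and remainder. The remainder is bounded by its vanishing coefficients, a form
  that includes \<open>r = 0\<close> when \<open>f\<close> is constant.
\<close>
lemma pseudo_division:
  assumes f: "f \<in> polys_over A" and p: "p \<in> polys_over I"
  shows "\<exists>s q r. q \<in> polys_over I \<and> r \<in> polys_over I \<and>
           smult (lead_coeff f ^ s) p = q * f + r \<and> (\<forall>i\<ge>degree f. coeff r i = 0)"
proof -
  define a k where "a = lead_coeff f" and "k = degree f"
  have a: "a \<in> A" using f by (simp add: a_def polys_over_def)
  have "\<exists>s q r. q \<in> polys_over I \<and> r \<in> polys_over I \<and>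
          smult (a ^ s) p = q * f + r \<and> (\<forall>i\<ge>k. coeff r i = 0)"
    if "p \<in> polys_over I" "\<forall>i\<ge>m. coeff p i = 0" for m and p :: "'a poly"
    using that
  proof (induction m arbitrary: p)
    case 0
    then show ?case
      by (intro exI[of _ 0] exI[of _ p]) (auto simp: polys_zero)
  next
    case (Suc m)
    show ?case
    proof (cases "m < k")
      case True
      then have "\<forall>i\<ge>k. coeff p i = 0" using Suc.prems by auto
      then show ?thesis using Suc.prems
        by (intro exI[of _ 0] exI[of _ p]) (auto simp: polys_zero)
    next
      case False
      \<comment> \<open>One step of long division cancels the coefficient at index \<open>m\<close>.\<close>
      define h where "h = monom (coeff p m) (m - k)"
      have h: "h \<in> polys_over I"
        using Suc.prems by (auto simp: h_def polys_over_def zero_ideal)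
      define p' where "p' = smult a p - h * f"
      have p': "p' \<in> polys_over I"
        unfolding p'_def by (intro polys_diff polys_smult polys_mult_right a h f Suc.prems)
      have "\<forall>i\<ge>m. coeff p' i = 0"
      proof (intro allI impI)
        fix i assume i: "i \<ge> m"
        have "coeff (h * f) i = coeff p m * coeff f (i - (m - k))"
          using i by (simp add: h_def coeff_monom_mult)
        then show "coeff p' i = 0"
          using i False Suc.prems
          by (cases "i = m") (auto simp: p'_def a_def k_def coeff_eq_0)
      qed
      from Suc.IH[OF p' this] obtain s q r where
        qr: "q \<in> polys_over I" "r \<in> polys_over I" "smult (a ^ s) p' = q * f + r"
          "\<forall>i\<ge>k. coeff r i = 0" by blast
      have "smult (a ^ Suc s) p = smult (a ^ s) p' + smult (a ^ s) (h * f)"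
        by (simp add: p'_def smult_diff_right mult.commute)
      also have "\<dots> = (q + smult (a ^ s) h) * f + r"
        by (simp add: qr algebra_simps)
      finally show ?thesis
        using qr h a
        by (intro exI[of _ "Suc s"] exI[of _ "q + smult (a ^ s) h"] exI[of _ r])
           (auto intro!: polys_add polys_smult power_mem)
    qed
  qed
  from this[of p "Suc (degree p)"] show ?thesis
    using p by (simp add: a_def k_def coeff_eq_0)
qed

text \<open>
  Over the nonzero quotient of \<open>A\<close> by \<open>I\<close>, a polynomial of positive degree whose leading
  coefficient is a unit is not invertible, because the top coefficients of a product with it cannot
  cancel. The quotient may have zero divisors, so a unit leading coefficient is what the
  degree argument requires.
\<close>
lemma polynomial_not_unit_mod_ideal:
  assumes one: "1 \<notin> I" and f: "f \<in> polys_over A" and deg: "degree f > 0"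
    and z: "z \<in> A" "lead_coeff f * z - 1 \<in> I"
    and m: "m \<in> polys_over I" and q: "q \<in> polys_over A"
  shows "m + q * f \<noteq> 1"
proof
  assume eq: "m + q * f = 1"
  have qf: "q * f = 1 - m" using eq by (simp add: algebra_simps)
  have "q \<in> polys_over I"
  proof (rule ccontr)
    assume "q \<notin> polys_over I"
    then obtain i where i: "coeff q i \<notin> I" by (auto simp: polys_over_def)
    \<comment> \<open>\<open>j\<close> is the degree of \<open>q\<close> modulo \<open>I\<close>; the coefficient of \<open>q * f\<close> at \<open>j + degree f\<close> is
      then, modulo \<open>I\<close>, the product of the two leading coefficients.\<close>
    define j where "j = Max {i. coeff q i \<notin> I}"
    have fin: "finite {i. coeff q i \<notin> I}"
      by (rule finite_subset[of _ "{..degree q}"]) (auto simp: zero_ideal intro: le_degree)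
    have j: "coeff q j \<notin> I" using Max_in[OF fin] i by (auto simp: j_def)
    have above: "coeff q l \<in> I" if "l > j" for l
      using Max_ge[OF fin, of l] that by (auto simp: j_def)
    let ?n = "j + degree f"
    have "coeff (q * f) ?n = (\<Sum>l\<le>?n. coeff q l * coeff f (?n - l))"
      by (simp add: coeff_mult)
    also have "\<dots> = coeff q j * lead_coeff f
                  + (\<Sum>l\<in>{..?n} - {j}. coeff q l * coeff f (?n - l))"
      by (subst sum.remove[of _ j]) auto
    finally have split: "lead_coeff f * coeff q j = coeff (q * f) ?n
                  - (\<Sum>l\<in>{..?n} - {j}. coeff q l * coeff f (?n - l))"
      by (simp add: algebra_simps)
    have "(\<Sum>l\<in>{..?n} - {j}. coeff q l * coeff f (?n - l)) \<in> I"
    proof (rule sum_ideal)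
      fix l assume l: "l \<in> {..?n} - {j}"
      show "coeff q l * coeff f (?n - l) \<in> I"
      proof (cases "l < j")
        case True
        then show ?thesis by (simp add: coeff_eq_0 zero_ideal)
      next
        case False
        then show ?thesis
          using l above[of l] f by (auto simp: polys_over_def intro: absorb_right)
      qed
    qed
    moreover have "coeff (q * f) ?n \<in> I"
      using m deg diff_ideal[OF zero_ideal] by (simp add: qf polys_over_def)
    ultimately have "lead_coeff f * coeff q j \<in> I"
      unfolding split by (rule diff_ideal[rotated])
    then have "coeff q j \<in> I"
      using cancel_unit[OF z] q by (simp add: polys_over_def)
    then show False using j by simp
  qed
  then have "m + q * f \<in> polys_over I"
    using m f by (intro polys_add polys_mult_right)
  then have "coeff (1 :: 'a poly) 0 \<in> I" unfolding eq polys_over_def by blast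
  then show False using one by simp
qed

end

section \<open>Finite quotients of finitely generated domains\<close>

definition finite_index :: "'a::ab_group_add set \<Rightarrow> 'a set \<Rightarrow> bool" where
  "finite_index I A \<longleftrightarrow> (\<exists>S. finite S \<and> (\<forall>x\<in>A. \<exists>s\<in>S. x - s \<in> I))"

definition unit_in_finite_quotient :: "'a::idom set \<Rightarrow> 'a \<Rightarrow> 'a set \<Rightarrow> bool" where
  "unit_in_finite_quotient A y I \<longleftrightarrow>
     subring_ideal A I \<and> finite_index I A \<and> 1 \<notin> I \<and> (\<exists>z\<in>A. y * z - 1 \<in> I)"

text \<open>
  The property that passes from a ring to a simple extension. Since a product is a unit only
  if its factors are, one quotient serves any finite number of nonzero elements of a domain.
\<close>
definition detected_by_finite_quotients :: "'a::idom set \<Rightarrow> bool" where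
  "detected_by_finite_quotients A \<longleftrightarrow>
     subring_ideal A A \<and> (\<forall>y\<in>A. y \<noteq> 0 \<longrightarrow> (\<exists>I. unit_in_finite_quotient A y I))"

definition adjoin :: "'a::comm_semiring_0 set \<Rightarrow> 'a \<Rightarrow> 'a set" where
  "adjoin A t = (\<lambda>p. poly p t) ` polys_over A"

text \<open>
  The ideal of \<open>A[t]\<close> generated by \<open>I\<close> and \<open>u\<close>. Taking \<open>u = 0\<close> gives the plain extension of
  \<open>I\<close>, so that the transcendental and the algebraic case can share their lemmas.
\<close>
definition ideal_of_adjoin :: "'a::idom set \<Rightarrow> 'a set \<Rightarrow> 'a \<Rightarrow> 'a \<Rightarrow> 'a set" where
  "ideal_of_adjoin A I t u =
     {poly m t + poly q t * u | m q. m \<in> polys_over I \<and> q \<in> polys_over A}"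

context subring_ideal
begin

interpretation R: subring_ideal A A by (rule whole_ring)

lemma ideal_of_adjoin_is_ideal:
  assumes "u \<in> adjoin A t"
  shows "subring_ideal (adjoin A t) (ideal_of_adjoin A I t u)"
proof
  show "1 \<in> adjoin A t"
    unfolding adjoin_def
    by (rule image_eqI[of _ _ 1]) (auto simp: polys_over_def coeff_1 one_mem zero_mem)
next
  fix x y assume "x \<in> adjoin A t" "y \<in> adjoin A t"
  then obtain p q where pq: "x = poly p t" "y = poly q t" "p \<in> polys_over A" "q \<in> polys_over A"
    by (auto simp: adjoin_def)
  show "x - y \<in> adjoin A t"
    unfolding adjoin_def by (rule image_eqI[of _ _ "p - q"]) (auto simp: pq intro: R.polys_diff)
  show "x * y \<in> adjoin A t"
    unfolding adjoin_def by (rule image_eqI[of _ _ "p * q"]) (auto simp: pq intro: R.polys_mult)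
next
  obtain g where g: "u = poly g t" "g \<in> polys_over A" using assms by (auto simp: adjoin_def)
  show "ideal_of_adjoin A I t u \<subseteq> adjoin A t"
  proof
    fix x assume "x \<in> ideal_of_adjoin A I t u"
    then obtain m q where mq: "x = poly m t + poly q t * u" "m \<in> polys_over I" "q \<in> polys_over A"
      by (auto simp: ideal_of_adjoin_def)
    show "x \<in> adjoin A t"
      unfolding adjoin_def
      by (rule image_eqI[of _ _ "m + q * g"])
         (use mq g polys_over_mono in \<open>auto intro!: R.polys_add R.polys_mult\<close>)
  qed
next
  show "0 \<in> ideal_of_adjoin A I t u"
    using polys_zero R.polys_zero by (force simp: ideal_of_adjoin_def)
next
  fix x y assume "x \<in> ideal_of_adjoin A I t u" "y \<in> ideal_of_adjoin A I t u"
  then obtain m q m' q' where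
    mq: "x = poly m t + poly q t * u" "m \<in> polys_over I" "q \<in> polys_over A"
    "y = poly m' t + poly q' t * u" "m' \<in> polys_over I" "q' \<in> polys_over A"
    by (auto simp: ideal_of_adjoin_def)
  have "x - y = poly (m - m') t + poly (q - q') t * u" by (simp add: mq algebra_simps)
  then show "x - y \<in> ideal_of_adjoin A I t u"
    using mq polys_diff R.polys_diff unfolding ideal_of_adjoin_def by blast
next
  fix a x assume "a \<in> adjoin A t" "x \<in> ideal_of_adjoin A I t u"
  then obtain p m q where
    mq: "x = poly m t + poly q t * u" "m \<in> polys_over I" "q \<in> polys_over A"
    "a = poly p t" "p \<in> polys_over A"
    by (auto simp: ideal_of_adjoin_def adjoin_def)
  have "a * x = poly (p * m) t + poly (p * q) t * u" by (simp add: mq algebra_simps)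
  then show "a * x \<in> ideal_of_adjoin A I t u"
    using mq polys_mult R.polys_mult unfolding ideal_of_adjoin_def by blast
qed

lemma subset_adjoin: "A \<subseteq> adjoin A t"
proof
  fix a assume "a \<in> A"
  then show "a \<in> adjoin A t"
    unfolding adjoin_def by (intro image_eqI[of _ _ "monom a 0"] R.polys_monom) (auto simp: poly_monom)
qed

lemma generator_in_adjoin: "t \<in> adjoin A t"
  unfolding adjoin_def
  by (intro image_eqI[of _ _ "monom 1 1"] R.polys_monom) (auto simp: poly_monom one_mem)

lemma extended_ideal_subset:
  assumes "m \<in> polys_over I"
  shows "poly m t \<in> ideal_of_adjoin A I t u"
proof -
  have "poly m t = poly m t + poly 0 t * u" by simp
  then show ?thesis using assms R.polys_zero unfolding ideal_of_adjoin_def by blast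
qed

lemma new_generator_in_ideal: "u \<in> ideal_of_adjoin A I t u"
proof -
  have "u = poly 0 t + poly 1 t * u" by simp
  moreover have "1 \<in> polys_over A" by (auto simp: polys_over_def coeff_1 one_mem zero_mem)
  ultimately show ?thesis using polys_zero unfolding ideal_of_adjoin_def by blast
qed

lemma ideal_subset_ideal_of_adjoin: "I \<subseteq> ideal_of_adjoin A I t u"
proof
  fix x assume "x \<in> I"
  then have "poly (monom x 0) t \<in> ideal_of_adjoin A I t u"
    by (intro extended_ideal_subset polys_monom)
  then show "x \<in> ideal_of_adjoin A I t u" by (simp add: poly_monom)
qed

text \<open>
  Modulo the ideal, \<open>t\<close> satisfies the equation \<open>f(t) = 0\<close>, whose leading coefficient is a unit.
  Hence the quotient is spanned by the powers of \<open>t\<close> below the degree of \<open>f\<close>, with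
  coefficients that matter only modulo \<open>I\<close>.
\<close>
lemma finite_index_ideal_of_adjoin:
  assumes fin: "finite_index I A" and f: "f \<in> polys_over A"
    and z: "z \<in> A" "lead_coeff f * z - 1 \<in> I"
  shows "finite_index (ideal_of_adjoin A I t (poly f t)) (adjoin A t)"
proof -
  let ?J = "ideal_of_adjoin A I t (poly f t)" and ?B = "adjoin A t"
  interpret B: subring_ideal ?B ?J
    by (rule ideal_of_adjoin_is_ideal) (use f in \<open>auto simp: adjoin_def\<close>)
  obtain S where S: "finite S" "\<And>x. x \<in> A \<Longrightarrow> \<exists>s\<in>S. x - s \<in> I"
    using fin by (auto simp: finite_index_def)
  then obtain \<sigma> where \<sigma>: "\<And>x. x \<in> A \<Longrightarrow> \<sigma> x \<in> S" "\<And>x. x \<in> A \<Longrightarrow> x - \<sigma> x \<in> I" by metis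
  define k where "k = degree f"
  define T where "T = (\<lambda>c. \<Sum>i<k. c i * t ^ i) ` ({..<k} \<rightarrow>\<^sub>E S)"
  have "\<exists>s\<in>T. x - s \<in> ?J" if x: "x \<in> ?B" for x
  proof -
    obtain p where p: "x = poly p t" "p \<in> polys_over A" using x by (auto simp: adjoin_def)
    obtain s q r where qr: "q \<in> polys_over A" "r \<in> polys_over A"
        "smult (lead_coeff f ^ s) p = q * f + r" "\<forall>i\<ge>k. coeff r i = 0"
      using R.pseudo_division[OF f p(2)] unfolding k_def by blast
    \<comment> \<open>Multiplying by \<open>z ^ s\<close> undoes, modulo \<open>I\<close>, the factor introduced by pseudo-division.\<close>
    define r' where "r' = smult (z ^ s) r"
    have r': "r' \<in> polys_over A"
      unfolding r'_def using z qr by (intro R.polys_smult power_mem)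
    define c where "c = restrict (\<lambda>i. \<sigma> (coeff r' i)) {..<k}"
    define e where "e = r' - (\<Sum>i<k. monom (c i) i)"
    have "coeff e i = (if i < k then coeff r' i - \<sigma> (coeff r' i) else 0)" for i
      using qr(4) by (auto simp: e_def c_def coeff_sum r'_def)
    then have e: "e \<in> polys_over I"
      using r' by (auto simp: polys_over_def zero_ideal \<sigma>)
    have "lead_coeff f ^ s * x = poly q t * poly f t + poly r t"
      using arg_cong[OF qr(3), of "\<lambda>p. poly p t"] by (simp add: p)
    then have "poly r' t = z ^ s * (lead_coeff f ^ s * x - poly q t * poly f t)"
      by (simp add: r'_def)
    then have "x - poly r' t
        = z ^ s * poly q t * poly f t - x * ((lead_coeff f * z) ^ s - 1)"
      by (simp add: algebra_simps power_mult_distrib)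
    moreover have "x * ((lead_coeff f * z) ^ s - 1) \<in> ?J"
      using unit_power[of "lead_coeff f" z s] z f ideal_subset_ideal_of_adjoin x
      by (intro B.absorb) (auto simp: polys_over_def)
    moreover have "z ^ s * poly q t * poly f t \<in> ?J"
      using z qr subset_adjoin power_mem[of z s]
      by (intro B.absorb B.mult_mem new_generator_in_ideal) (auto simp: adjoin_def)
    ultimately have "x - poly r' t \<in> ?J" by (simp add: B.diff_ideal)
    moreover have "poly e t \<in> ?J" by (rule extended_ideal_subset[OF e])
    ultimately have "(x - poly r' t) + poly e t \<in> ?J" by (rule B.add_ideal)
    then have "x - (\<Sum>i<k. c i * t ^ i) \<in> ?J"
      by (simp add: e_def poly_sum poly_monom)
    moreover have "(\<Sum>i<k. c i * t ^ i) \<in> T"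
      unfolding T_def c_def using r' by (intro imageI restrict_PiE_iff[THEN iffD2]) (auto simp: polys_over_def \<sigma>)
    ultimately show ?thesis by blast
  qed
  moreover have "finite T" unfolding T_def using S by (intro finite_imageI finite_PiE) auto
  ultimately show ?thesis unfolding finite_index_def by blast
qed

end

lemma adjoin_subring:
  assumes "subring_ideal A A"
  shows "subring_ideal (adjoin A t) (adjoin A t)"
proof -
  interpret subring_ideal A A by fact
  have "subring_ideal (adjoin A t) (ideal_of_adjoin A A t t)"
    by (rule ideal_of_adjoin_is_ideal[OF generator_in_adjoin])
  then show ?thesis by (rule subring_ideal.whole_ring)
qed

text \<open>
  For transcendental \<open>t\<close>, an element of \<open>A[t]\<close> is a polynomial \<open>g\<close>. Take \<open>I\<close> such that the leading
  coefficient of \<open>g\<close> is a unit modulo \<open>I\<close>. Dividing out \<open>1 + t g\<close> as well makes \<open>g\<close> a unit with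
  inverse \<open>- t\<close>. The quotient stays nonzero because \<open>1 + t g\<close> has positive degree, whatever
  the degree of \<open>g\<close>, and the leading coefficient of \<open>g\<close>.
\<close>
lemma finite_quotient_adjoin_transcendental:
  assumes A: "detected_by_finite_quotients A"
    and trans: "\<And>p. p \<in> polys_over A \<Longrightarrow> poly p t = 0 \<Longrightarrow> p = 0"
    and y: "y \<in> adjoin A t" "y \<noteq> 0"
  shows "\<exists>J. unit_in_finite_quotient (adjoin A t) y J"
proof -
  obtain g where g: "y = poly g t" "g \<in> polys_over A" using y by (auto simp: adjoin_def)
  have "g \<noteq> 0" using g y by auto
  then have "lead_coeff g \<in> A" "lead_coeff g \<noteq> 0" using g by (auto simp: polys_over_def)
  then obtain I z where I: "subring_ideal A I" "finite_index I A" "1 \<notin> I"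
      and z: "z \<in> A" "lead_coeff g * z - 1 \<in> I"
    using A unfolding detected_by_finite_quotients_def unit_in_finite_quotient_def by metis
  interpret subring_ideal A I by fact
  interpret R: subring_ideal A A by (rule whole_ring)
  define f where "f = pCons 1 g"
  have f: "f \<in> polys_over A" "lead_coeff f = lead_coeff g" "degree f > 0" "poly f t = 1 + t * y"
    using g \<open>g \<noteq> 0\<close> by (auto simp: f_def polys_over_def coeff_pCons one_mem split: nat.splits)
  let ?J = "ideal_of_adjoin A I t (poly f t)"
  have ft: "poly f t \<in> adjoin A t" using f(1) unfolding adjoin_def by (rule imageI)
  interpret B: subring_ideal "adjoin A t" ?J by (rule ideal_of_adjoin_is_ideal[OF ft])
  have "1 \<notin> ?J"
  proof
    assume "1 \<in> ?J"
    then obtain m q where mq: "1 = poly m t + poly q t * poly f t"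
      "m \<in> polys_over I" "q \<in> polys_over A" by (auto simp: ideal_of_adjoin_def)
    have "m + q * f - 1 \<in> polys_over A"
      using mq polys_over_mono f R.polys_monom[OF one_mem, of 0]
      by (intro R.polys_diff R.polys_add R.polys_mult) (auto simp: monom_0 one_pCons)
    moreover have "poly (m + q * f - 1) t = 0" using mq by simp
    ultimately have "m + q * f - 1 = 0" by (rule trans)
    then show False
      using polynomial_not_unit_mod_ideal[OF I(3) f(1,3) z(1) _ mq(2,3)] z f(2) by simp
  qed
  moreover have "finite_index ?J (adjoin A t)"
    using finite_index_ideal_of_adjoin[OF I(2) f(1) z(1)] z f(2) by simp
  moreover have "y * (0 - t) - 1 \<in> ?J"
  proof -
    have "0 - poly f t \<in> ?J" by (intro B.diff_ideal B.zero_ideal new_generator_in_ideal)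
    moreover have "0 - poly f t = y * (0 - t) - 1" by (simp add: f algebra_simps)
    ultimately show ?thesis by (simp only:)
  qed
  ultimately show ?thesis
    unfolding unit_in_finite_quotient_def
    using B.subring_ideal_axioms generator_in_adjoin B.diff_mem[OF B.zero_mem] by blast
qed

text \<open>
  Minimality is stated through vanishing coefficients, the form in which pseudo-division delivers
  its remainder.
\<close>
lemma minimal_polynomial_exists:
  assumes "p \<in> polys_over A" "poly p t = 0" "p \<noteq> 0"
  obtains f where "f \<in> polys_over A" "poly f t = 0" "f \<noteq> 0"
    "\<And>g. g \<in> polys_over A \<Longrightarrow> poly g t = 0 \<Longrightarrow> \<forall>i\<ge>degree f. coeff g i = 0 \<Longrightarrow> g = 0"
proof -
  define P where "P f \<longleftrightarrow> f \<in> polys_over A \<and> poly f t = 0 \<and> f \<noteq> 0" for f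
  obtain f where f: "P f" "\<And>g. P g \<Longrightarrow> degree f \<le> degree g"
    using ex_has_least_nat[of P p degree] assms unfolding P_def by blast
  show thesis
  proof (rule that[of f])
    fix g assume g: "g \<in> polys_over A" "poly g t = 0" "\<forall>i\<ge>degree f. coeff g i = 0"
    show "g = 0"
    proof (rule ccontr)
      assume "g \<noteq> 0"
      then have "degree f \<le> degree g" using f(2) g by (auto simp: P_def)
      then have "lead_coeff g = 0" using g by blast
      then show False using \<open>g \<noteq> 0\<close> by simp
    qed
  qed (use f in \<open>auto simp: P_def\<close>)
qed

lemma degree_pos_of_root:
  assumes "poly f t = 0" "f \<noteq> 0"
  shows "degree f > 0"
proof (rule ccontr)
  assume "\<not> degree f > 0"
  then obtain c where "f = [:c:]" by (auto elim: degree_eq_zeroE)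
  then show False using assms by auto
qed

text \<open>
  Every nonzero ideal of an algebraic extension meets the base ring nontrivially. Among the
  polynomials over \<open>A\<close> whose value at \<open>t\<close> is a nonzero multiple of \<open>y\<close>, one of least degree is
  constant: dividing it by the minimal polynomial \<open>f\<close> shows that its degree is below that of
  \<open>f\<close>, and dividing \<open>f\<close> by it leaves a remainder that would be a smaller choice unless
  it vanishes, in which case a nonzero constant multiple of \<open>f\<close> would have a proper factor with
  root \<open>t\<close>.
\<close>
lemma algebraic_multiple_in_base:
  assumes A: "subring_ideal A A" and f: "f \<in> polys_over A" "poly f t = 0" "f \<noteq> 0"
    and min: "\<And>g. g \<in> polys_over A \<Longrightarrow> poly g t = 0 \<Longrightarrow> \<forall>i\<ge>degree f. coeff g i = 0 \<Longrightarrow> g = 0"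
    and y: "y \<in> adjoin A t" "y \<noteq> 0"
  obtains w where "w \<in> adjoin A t" "y * w \<in> A" "y * w \<noteq> 0"
proof -
  interpret subring_ideal A A by fact
  interpret B: subring_ideal "adjoin A t" "adjoin A t" by (rule adjoin_subring[OF A])
  define P where "P h \<longleftrightarrow> h \<in> polys_over A \<and> poly h t \<noteq> 0 \<and>
     (\<exists>w\<in>adjoin A t. poly h t = y * w)" for h
  obtain g where g: "y = poly g t" "g \<in> polys_over A" using y by (auto simp: adjoin_def)
  have "P g" using g y B.one_mem by (auto simp: P_def intro!: bexI[of _ 1])
  then obtain h where h: "P h" "\<And>h'. P h' \<Longrightarrow> degree h \<le> degree h'"
    using ex_has_least_nat[of P g degree] by blast
  obtain w where w: "w \<in> adjoin A t" "poly h t = y * w" using h by (auto simp: P_def)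
  have hA: "h \<in> polys_over A" and hne: "poly h t \<noteq> 0" using h by (auto simp: P_def)
  then have "h \<noteq> 0" by auto
  have small: "degree r < n" if "\<forall>i\<ge>n. coeff r i = 0" "r \<noteq> 0" for r :: "'a poly" and n
    using that leading_coeff_neq_0[of r] by (meson not_le)
  have hf: "degree h < degree f"
  proof -
    obtain s q r where qr: "q \<in> polys_over A" "r \<in> polys_over A"
        "smult (lead_coeff f ^ s) h = q * f + r" "\<forall>i\<ge>degree f. coeff r i = 0"
      using pseudo_division[OF f(1) hA] by blast
    have rt: "poly r t = lead_coeff f ^ s * poly h t"
      using arg_cong[OF qr(3), of "\<lambda>p. poly p t"] f by simp
    then have "poly r t \<noteq> 0" using hne f by simp
    moreover have "poly r t = y * (lead_coeff f ^ s * w)" using rt w by simp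
    moreover have "lead_coeff f ^ s * w \<in> adjoin A t"
      using f subset_adjoin w by (intro B.mult_mem B.power_mem) (auto simp: polys_over_def)
    ultimately have "P r" using qr by (auto simp: P_def)
    then show ?thesis using h(2)[of r] small[OF qr(4)] \<open>poly r t \<noteq> 0\<close> by fastforce
  qed
  have "degree h = 0"
  proof (rule ccontr)
    assume d: "degree h \<noteq> 0"
    obtain s q r where qr: "q \<in> polys_over A" "r \<in> polys_over A"
        "smult (lead_coeff h ^ s) f = q * h + r" "\<forall>i\<ge>degree h. coeff r i = 0"
      using pseudo_division[OF hA f(1)] by blast
    have rt: "poly r t = - poly q t * poly h t"
      using arg_cong[OF qr(3), of "\<lambda>p. poly p t"] f by (simp add: eq_neg_iff_add_eq_0 add.commute)
    have "poly r t = 0"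
    proof (rule ccontr)
      assume ne: "poly r t \<noteq> 0"
      have "poly r t = y * ((0 - poly q t) * w)" using rt w by simp
      moreover have "(0 - poly q t) * w \<in> adjoin A t"
        using qr w by (intro B.mult_mem B.diff_mem B.zero_mem) (auto simp: adjoin_def)
      ultimately have "P r" using qr ne unfolding P_def by blast
      then show False using h(2)[of r] small[OF qr(4)] ne by fastforce
    qed
    then have "r = 0" using min[of r] qr hf by auto
    have "poly q t = 0" using rt \<open>poly r t = 0\<close> hne by simp
    have sf: "smult (lead_coeff h ^ s) f = q * h" using qr \<open>r = 0\<close> by simp
    have "smult (lead_coeff h ^ s) f \<noteq> 0" using f \<open>h \<noteq> 0\<close> by simp
    then have "q \<noteq> 0" using sf by auto
    have "degree f = degree q + degree h"
      using arg_cong[OF sf, of degree] \<open>q \<noteq> 0\<close> \<open>h \<noteq> 0\<close> by (simp add: degree_mult_eq)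
    then have "q = 0" using min[of q] qr \<open>poly q t = 0\<close> d by (auto simp: coeff_eq_0)
    then show False using \<open>q \<noteq> 0\<close> by simp
  qed
  then obtain c where c: "h = [:c:]" by (auto elim: degree_eq_zeroE)
  have "coeff h 0 \<in> A" using hA by (auto simp: polys_over_def)
  then show thesis using that[of w] w hne by (simp add: c)
qed

text \<open>
  For algebraic \<open>t\<close>, replace \<open>y\<close> by a nonzero multiple in \<open>A\<close>, and choose \<open>I\<close> such that this
  multiple and the leading coefficient \<open>a\<close> of the minimal polynomial are units modulo \<open>I\<close>. The
  extension of \<open>I\<close> to \<open>A[t]\<close> remains proper: if \<open>1 = m(t)\<close> with coefficients of \<open>m\<close> in \<open>I\<close>,
  then reducing \<open>m\<close> by the minimal polynomial writes a power of \<open>a\<close> as a combination of the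
  lower powers of \<open>t\<close> with coefficients in \<open>I\<close>. As these powers are linearly independent, that
  power of \<open>a\<close> lies in \<open>I\<close>, although \<open>a\<close> is a unit.
\<close>
lemma finite_quotient_adjoin_algebraic:
  assumes A: "detected_by_finite_quotients A"
    and p: "p \<in> polys_over A" "poly p t = 0" "p \<noteq> 0"
    and y: "y \<in> adjoin A t" "y \<noteq> 0"
  shows "\<exists>J. unit_in_finite_quotient (adjoin A t) y J"
proof -
  have AA: "subring_ideal A A" using A by (simp add: detected_by_finite_quotients_def)
  interpret R: subring_ideal A A by fact
  obtain f where f: "f \<in> polys_over A" "poly f t = 0" "f \<noteq> 0" and
    min: "\<And>g. g \<in> polys_over A \<Longrightarrow> poly g t = 0 \<Longrightarrow> \<forall>i\<ge>degree f. coeff g i = 0 \<Longrightarrow> g = 0"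
    using minimal_polynomial_exists[OF p] by metis
  obtain w where w: "w \<in> adjoin A t" "y * w \<in> A" "y * w \<noteq> 0"
    by (rule algebraic_multiple_in_base[OF AA f _ y]) (use min in blast)+
  define a where "a = lead_coeff f"
  have a: "a \<in> A" "a \<noteq> 0" using f by (auto simp: a_def polys_over_def)
  obtain I z where I: "subring_ideal A I" "finite_index I A" "1 \<notin> I"
      and z: "z \<in> A" "(a * (y * w)) * z - 1 \<in> I"
    using A R.mult_mem[OF a(1) w(2)] a(2) w(3)
    unfolding detected_by_finite_quotients_def unit_in_finite_quotient_def
    by (metis mult_eq_0_iff)
  interpret subring_ideal A I by fact
  have az: "(y * w) * z \<in> A" "a * ((y * w) * z) - 1 \<in> I"
    using z R.mult_mem[OF w(2) z(1)] by (simp_all add: mult.assoc)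
  let ?J = "ideal_of_adjoin A I t (poly f t)"
  have ft: "poly f t \<in> adjoin A t" using f(1) by (auto simp: adjoin_def)
  interpret B: subring_ideal "adjoin A t" ?J by (rule ideal_of_adjoin_is_ideal[OF ft])
  have "1 \<notin> ?J"
  proof
    assume "1 \<in> ?J"
    then obtain m where m: "1 = poly m t" "m \<in> polys_over I"
      using f(2) by (auto simp: ideal_of_adjoin_def)
    obtain s q r where qr: "q \<in> polys_over I" "r \<in> polys_over I"
        "smult (a ^ s) m = q * f + r" "\<forall>i\<ge>degree f. coeff r i = 0"
      using pseudo_division[OF f(1) m(2)] unfolding a_def by blast
    have rt: "poly r t = a ^ s"
      using arg_cong[OF qr(3), of "\<lambda>p. poly p t"] f m by simp
    have degf: "degree f > 0" by (rule degree_pos_of_root[OF f(2,3)])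
    have "r - monom (a ^ s) 0 = 0"
    proof (rule min)
      show "r - monom (a ^ s) 0 \<in> polys_over A"
        using qr(2) polys_over_mono a by (intro R.polys_diff R.polys_monom power_mem) auto
    qed (use qr rt degf in \<open>auto simp: poly_monom\<close>)
    then have "coeff r 0 = a ^ s" by simp
    then have "a ^ s \<in> I" using qr(2) unfolding polys_over_def by (metis mem_Collect_eq)
    then show False using cancel_unit_power[OF a(1) az] I(3) by blast
  qed
  moreover have "finite_index ?J (adjoin A t)"
    using finite_index_ideal_of_adjoin[OF I(2) f(1) az(1)] az by (simp add: a_def)
  moreover have "y * (w * (a * z)) - 1 \<in> ?J"
    using z ideal_subset_ideal_of_adjoin by (auto simp: algebra_simps)
  moreover have "w * (a * z) \<in> adjoin A t"
    using w a z R.subset_adjoin by (intro B.mult_mem) auto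
  ultimately show ?thesis
    unfolding unit_in_finite_quotient_def using B.subring_ideal_axioms by blast
qed

lemma detected_by_finite_quotients_adjoin:
  assumes "detected_by_finite_quotients A"
  shows "detected_by_finite_quotients (adjoin A t)"
  using finite_quotient_adjoin_transcendental[OF assms, of t]
    finite_quotient_adjoin_algebraic[OF assms, of _ t] adjoin_subring assms
  unfolding detected_by_finite_quotients_def by blast

lemma Ints_subring: "subring_ideal (\<int> :: 'a::idom set) \<int>"
  by unfold_locales auto

text \<open>A nonzero integer is a unit modulo every prime that exceeds its absolute value.\<close>
lemma detected_by_finite_quotients_Ints:
  "detected_by_finite_quotients (\<int> :: 'a::{idom, ring_char_0} set)"
proof -
  have "\<exists>I. unit_in_finite_quotient \<int> y I" if y: "y \<in> \<int>" "y \<noteq> 0" for y :: 'a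
  proof -
    obtain n where n: "y = of_int n" "n \<noteq> 0" using y by (auto elim: Ints_cases)
    obtain p where p: "prime p" "p > nat \<bar>n\<bar>" using bigger_prime by blast
    have "\<not> int p dvd n"
      using p n zdvd_imp_le[of "int p" "\<bar>n\<bar>"] by auto
    then have "coprime n (int p)"
      using p by (metis coprime_commute prime_imp_coprime prime_nat_int_transfer)
    then obtain m where m: "int p dvd n * m - 1"
      by (metis coprime_iff_invertible_int cong_iff_dvd_diff)
    let ?I = "{of_int (int p * k) | k. True} :: 'a set"
    have "subring_ideal \<int> ?I"
    proof
      fix x y :: 'a assume "x \<in> ?I" "y \<in> ?I"
      then obtain k l where "x = of_int (int p * k)" "y = of_int (int p * l)" by auto
      then have "x - y = of_int (int p * (k - l))" by (simp add: algebra_simps)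
      then show "x - y \<in> ?I" by blast
    next
      fix a x :: 'a assume "a \<in> \<int>" "x \<in> ?I"
      then obtain k l where "a = of_int l" "x = of_int (int p * k)"
        unfolding Ints_def by blast
      then have "a * x = of_int (int p * (l * k))" by (simp add: algebra_simps)
      then show "a * x \<in> ?I" by blast
    next
      show "0 \<in> ?I" by (auto intro!: exI[of _ 0])
    qed auto
    moreover have "finite_index ?I \<int>"
      unfolding finite_index_def
    proof (intro exI conjI ballI)
      show "finite (of_int ` {0..<int p} :: 'a set)" by simp
      fix x :: 'a assume "x \<in> \<int>"
      then obtain k where k: "x = of_int k" by (auto elim: Ints_cases)
      show "\<exists>s\<in>of_int ` {0..<int p}. x - s \<in> ?I"
      proof (rule bexI[of _ "of_int (k mod int p)"])
        have "k - k mod int p = int p * (k div int p)" by (simp add: minus_mod_eq_mult_div)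
        then show "x - of_int (k mod int p) \<in> ?I" unfolding k by (metis (mono_tags, lifting) mem_Collect_eq of_int_diff)
        show "of_int (k mod int p) \<in> (of_int ` {0..<int p} :: 'a set)"
          using p by (intro imageI) (auto simp: prime_gt_0_nat)
      qed
    qed
    moreover have "1 \<notin> ?I"
    proof
      assume "1 \<in> ?I"
      then obtain k where "(of_int 1 :: 'a) = of_int (int p * k)" by auto
      then have "1 = int p * k" by (simp only: of_int_eq_iff)
      then have "int p dvd 1" by (rule dvdI)
      then show False using p by (auto dest: prime_gt_1_nat)
    qed
    moreover have "\<exists>z\<in>\<int>. y * z - 1 \<in> ?I"
    proof (rule bexI[of _ "of_int m"])
      obtain k where "n * m - 1 = int p * k" using m by (auto elim: dvdE)
      then have "y * of_int m - 1 = of_int (int p * k)"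
        unfolding n by (metis of_int_1 of_int_diff of_int_mult)
      then show "y * of_int m - 1 \<in> ?I" by blast
    qed auto
    ultimately show ?thesis unfolding unit_in_finite_quotient_def by blast
  qed
  then show ?thesis unfolding detected_by_finite_quotients_def using Ints_subring by blast
qed

text \<open>
  The ring is the one generated by \<open>X\<close>, built from the integers by adjoining the elements of \<open>X\<close>
  one after the other.
\<close>
lemma finite_set_in_detected_ring:
  fixes X :: "'a::{idom, ring_char_0} set"
  assumes "finite X"
  shows "\<exists>A. X \<subseteq> A \<and> detected_by_finite_quotients A"
  using assms
proof (induction X)
  case empty
  then show ?case using detected_by_finite_quotients_Ints by blast
next
  case (insert x X)
  then obtain A where A: "X \<subseteq> A" "detected_by_finite_quotients A" by blast
  then interpret subring_ideal A A by (simp add: detected_by_finite_quotients_def)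
  show ?case
    using A detected_by_finite_quotients_adjoin[OF A(2), of x] subset_adjoin[of x]
      generator_in_adjoin[of x] by blast
qed

section \<open>Linear recurrences modulo an ideal of finite index\<close>

context subring_ideal
begin

text \<open>
  By the pigeonhole principle two windows of \<open>r\<close> consecutive terms agree modulo \<open>I\<close>, and the
  recurrence carries the agreement forward. Since the last coefficient is a unit, the recurrence can
  also be solved for the oldest term, which carries the agreement back to the index \<open>N\<close>. It is
  essential that this index does not depend on \<open>I\<close>, because the ideal will be chosen after the
  term that it has to detect.
\<close>
lemma recurrence_periodic_mod_ideal:
  fixes u c :: "nat \<Rightarrow> 'a"
  assumes fin: "finite_index I A"
    and u: "\<And>n. n \<ge> N \<Longrightarrow> u n \<in> A"
    and c: "\<And>j. j \<in> {1..r} \<Longrightarrow> c j \<in> A"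
    and r: "r \<ge> 1"
    and unit: "z \<in> A" "c r * z - 1 \<in> I"
    and rec: "\<And>n. n \<ge> N \<Longrightarrow> u (n + r) = (\<Sum>j=1..r. c j * u (n + r - j))"
  obtains M where "M > 0" "\<And>n. n \<ge> N \<Longrightarrow> u (n + M) - u n \<in> I"
proof -
  obtain S where S: "finite S" "\<And>x. x \<in> A \<Longrightarrow> \<exists>s\<in>S. x - s \<in> I"
    using fin by (auto simp: finite_index_def)
  then obtain \<sigma> where \<sigma>: "\<And>x. x \<in> A \<Longrightarrow> \<sigma> x \<in> S" "\<And>x. x \<in> A \<Longrightarrow> x - \<sigma> x \<in> I" by metis
  define state where "state n = map (\<lambda>l. \<sigma> (u (N + n + l))) [0..<r]" for n
  have "range state \<subseteq> {xs. set xs \<subseteq> S \<and> length xs = r}"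
    using u by (auto simp: state_def intro!: \<sigma>)
  then have "finite (range state)"
    using finite_lists_length_eq[OF S(1)] by (rule finite_subset)
  then have "\<not> inj state" using finite_imageD by blast
  then obtain i j where ij: "i < j" "state i = state j"
    unfolding inj_def by (metis linorder_neqE_nat)
  define M where "M = j - i"
  define D where "D n = u (n + M) - u n" for n
  have DA: "D n \<in> A" if "n \<ge> N" for n
    using that u by (simp add: D_def diff_mem)
  have D_rec: "D (n + r) = (\<Sum>l=1..r. c l * D (n + r - l))" if "n \<ge> N" for n
  proof -
    have "D (n + r) = (\<Sum>l=1..r. c l * u (n + M + r - l)) - (\<Sum>l=1..r. c l * u (n + r - l))"
      using rec[of n] rec[of "n + M"] that by (simp add: D_def add.commute add.left_commute)
    also have "\<dots> = (\<Sum>l=1..r. c l * D (n + r - l))"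
      unfolding sum_subtractf[symmetric]
      by (rule sum.cong) (auto simp: D_def algebra_simps)
    finally show ?thesis .
  qed
  have start: "D (N + i + l) \<in> I" if "l < r" for l
  proof -
    have "\<sigma> (u (N + i + l)) = \<sigma> (u (N + j + l))"
      using arg_cong[OF ij(2), of "\<lambda>xs. xs ! l"] that by (simp add: state_def)
    moreover have "(u (N + j + l) - \<sigma> (u (N + j + l))) - (u (N + i + l) - \<sigma> (u (N + i + l))) \<in> I"
      using u by (intro diff_ideal \<sigma>) auto
    moreover have "N + i + l + M = N + j + l" using ij by (simp add: M_def)
    ultimately show ?thesis by (simp only: D_def) simp
  qed
  have forward: "D n \<in> I" if "n \<ge> N + i" for n
    using that
  proof (induction n rule: less_induct)
    case (less n)
    show ?case
    proof (cases "n < N + i + r")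
      case True
      then show ?thesis using start[of "n - (N + i)"] less.prems by simp
    next
      case False
      then obtain m where m: "n = m + r" "m \<ge> N + i" by (intro that[of "n - r"]) auto
      have "(\<Sum>l=1..r. c l * D (m + r - l)) \<in> I"
        using m by (intro sum_ideal absorb c less.IH) auto
      then show ?thesis using D_rec[of m] m by simp
    qed
  qed
  have backward: "D n \<in> I" if "n \<ge> N" "\<And>n'. n' > n \<Longrightarrow> D n' \<in> I" for n
  proof -
    have "D (n + r) = c r * D n + (\<Sum>l\<in>{1..r} - {r}. c l * D (n + r - l))"
      using D_rec[OF that(1)] r sum.remove[of "{1..r}" r "\<lambda>l. c l * D (n + r - l)"] by simp
    moreover have "(\<Sum>l\<in>{1..r} - {r}. c l * D (n + r - l)) \<in> I"
      by (intro sum_ideal absorb c that) auto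
    moreover have "D (n + r) \<in> I" using r by (intro that) auto
    ultimately have "c r * D n \<in> I" using diff_ideal by fastforce
    then show ?thesis using cancel_unit[OF unit DA[OF that(1)]] by simp
  qed
  have "D n \<in> I" if "n \<ge> N" for n
  proof -
    have "\<forall>n\<ge>N + i - k. n \<ge> N \<longrightarrow> D n \<in> I" for k
    proof (induction k)
      case (Suc k)
      show ?case
      proof (intro allI impI)
        fix n assume n: "n \<ge> N + i - Suc k" "n \<ge> N"
        show "D n \<in> I"
          by (rule backward[OF n(2)]) (use n Suc in auto)
      qed
    qed (use forward in auto)
    from this[of i] that show ?thesis by simp
  qed
  then show thesis using that[of M] ij by (auto simp: M_def D_def)
qed

text \<open>The modulus is a multiple of the period, so that two sequences can share it.\<close>
lemma periodic_mod_ideal_cong: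
  fixes u :: "nat \<Rightarrow> 'a"
  assumes per: "\<And>n. n \<ge> N \<Longrightarrow> u (n + M) - u n \<in> I"
    and n: "n \<ge> N" "n' \<ge> N" "[n = n'] (mod M * K)"
  shows "u n - u n' \<in> I"
proof -
  have shift: "u (n + k * M) - u n \<in> I" if "n \<ge> N" for n k
  proof (induction k)
    case (Suc k)
    have "(u (n + k * M + M) - u (n + k * M)) + (u (n + k * M) - u n) \<in> I"
      using that by (intro add_ideal per Suc) auto
    then show ?case by (simp add: algebra_simps)
  qed (simp add: zero_ideal)
  have ordered: "u n' - u n \<in> I" if le: "n \<ge> N" "n \<le> n'" "[n = n'] (mod M * K)" for n n'
  proof -
    obtain k where "n' = k * (M * K) + n"
      using cong_le_nat[OF le(2), of "M * K"] cong_sym[OF le(3)] by blast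
    moreover have "k * (M * K) + n = n + k * K * M" by (simp add: algebra_simps)
    ultimately have "n' = n + k * K * M" by (rule trans)
    then show ?thesis using shift[OF le(1), of "k * K"] by (simp only:)
  qed
  show ?thesis
  proof (cases "n \<le> n'")
    case True
    then show ?thesis using ordered[OF n(1) _ n(3)] minus_commute_ideal by blast
  next
    case False
    then show ?thesis using ordered[OF n(2) _ cong_sym[OF n(3)]] by simp
  qed
qed

end

section \<open>Divisor sums that are periodic modulo an ideal\<close>

lemma divisors_mult_prime_power:
  fixes n p :: nat
  assumes p: "prime p" and n: "\<not> p dvd n"
  shows "{d. d dvd n * p ^ Suc k} = {d. d dvd n * p ^ k} \<union> (\<lambda>d. d * p ^ Suc k) ` {d. d dvd n}"
    and "{d. d dvd n * p ^ k} \<inter> (\<lambda>d. d * p ^ Suc k) ` {d. d dvd n} = {}"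
proof -
  have "d dvd n * p ^ k \<or> d \<in> (\<lambda>d. d * p ^ Suc k) ` {d. d dvd n}" if "d dvd n * p ^ Suc k" for d
  proof -
    obtain e g where eg: "d = e * g" "e dvd n" "g dvd p ^ Suc k"
      using division_decomp[OF \<open>d dvd n * p ^ Suc k\<close>] by blast
    obtain j where j: "j \<le> Suc k" "g = p ^ j"
      using divides_primepow_nat[OF p] eg(3) by blast
    show ?thesis
    proof (cases "j = Suc k")
      case True
      then show ?thesis using eg j by auto
    next
      case False
      then have "p ^ j dvd p ^ k" using j by (intro le_imp_power_dvd) auto
      then show ?thesis using eg j by (auto intro: mult_dvd_mono)
    qed
  qed
  moreover have "d dvd n * p ^ Suc k" if "d dvd n * p ^ k" for d
    using dvd_mult[OF that, of p] by (simp add: mult_ac)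
  ultimately show
    "{d. d dvd n * p ^ Suc k} = {d. d dvd n * p ^ k} \<union> (\<lambda>d. d * p ^ Suc k) ` {d. d dvd n}"
    by (auto simp del: power_Suc)
  show "{d. d dvd n * p ^ k} \<inter> (\<lambda>d. d * p ^ Suc k) ` {d. d dvd n} = {}"
  proof (rule ccontr)
    assume "\<not> ?thesis"
    then obtain e where "e * p ^ Suc k dvd n * p ^ k" by (auto simp del: power_Suc)
    then have "p ^ k * p dvd p ^ k * n" by (metis dvd_mult_right mult.commute power_Suc)
    then show False using n p by (auto simp: prime_gt_0_nat)
  qed
qed

lemma sum_divisors_mult_prime_power:
  fixes n p :: nat and f :: "nat \<Rightarrow> 'a::comm_monoid_add"
  assumes p: "prime p" and n: "\<not> p dvd n"
  shows "(\<Sum>d | d dvd n * p ^ Suc k. f d)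
       = (\<Sum>d | d dvd n * p ^ k. f d) + (\<Sum>d | d dvd n. f (d * p ^ Suc k))"
proof -
  have n0: "n > 0" using n by (cases n) auto
  have fin: "finite {d. d dvd n * p ^ k}" "finite {d. d dvd n}"
    using n0 p by (auto intro!: finite_divisors_nat simp: prime_gt_0_nat)
  have "inj_on (\<lambda>d. d * p ^ Suc k) {d. d dvd n}"
    using p by (auto simp: inj_on_def prime_gt_0_nat)
  then show ?thesis
    unfolding divisors_mult_prime_power(1)[OF assms]
    using fin divisors_mult_prime_power(2)[OF assms]
    by (subst sum.union_disjoint) (auto simp: sum.reindex)
qed

text \<open>
  Some residue class contains infinitely many primes, by pigeonhole. Discarding the primes up to
  \<open>M\<close> ensures that the class is prime to \<open>M\<close>.
\<close>
lemma infinite_primes_in_unit_class: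
  fixes M :: nat
  assumes "M > 0"
  obtains a where "coprime a M" "infinite {q. prime q \<and> [q = a] (mod M)}"
proof -
  define P where "P = {q::nat. prime q} - {..M}"
  have "infinite P" unfolding P_def using primes_infinite by simp
  moreover have "finite ((\<lambda>q. q mod M) ` P)"
    by (rule finite_subset[of _ "{..<M}"]) (use assms in auto)
  ultimately obtain a where a: "a \<in> P" "infinite {q \<in> P. q mod M = a mod M}"
    using pigeonhole_infinite by blast
  have "\<not> a dvd M" using a(1) assms by (auto simp: P_def dest: dvd_imp_le)
  then have "coprime a M" using a(1) by (auto simp: P_def prime_imp_coprime)
  moreover have "infinite {q. prime q \<and> [q = a] (mod M)}"
    by (rule infinite_super[OF _ a(2)]) (auto simp: P_def cong_def)
  ultimately show thesis by (rule that)
qed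

text \<open>
  The values \<open>b(npq)\<close> and \<open>b(np\<^sup>2)\<close> agree modulo \<open>I\<close>. Expanding both over the divisors \<open>d\<close> of
  \<open>n\<close>, everything cancels except the terms \<open>\<gamma>(dq)\<close>: the number \<open>npq\<close> has two new prime factors
  where \<open>np\<^sup>2\<close> has one.
\<close>
lemma (in subring_ideal) periodic_divisor_sum_vanishes:
  fixes \<gamma> b :: "nat \<Rightarrow> 'a"
  assumes b: "\<And>n. n \<ge> 1 \<Longrightarrow> b n = (\<Sum>d | d dvd n. \<gamma> d)"
    and M: "M > 0"
    and \<gamma>_per: "\<And>n n'. n \<ge> N \<Longrightarrow> n' \<ge> N \<Longrightarrow> [n = n'] (mod M) \<Longrightarrow> \<gamma> n - \<gamma> n' \<in> I"
    and b_per: "\<And>n n'. n \<ge> N \<Longrightarrow> n' \<ge> N \<Longrightarrow> [n = n'] (mod M) \<Longrightarrow> b n - b n' \<in> I"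
    and m: "m \<ge> N"
  shows "\<gamma> m \<in> I"
proof -
  obtain a where a: "coprime a M" "infinite {q. prime q \<and> [q = a] (mod M)}"
    using infinite_primes_in_unit_class[OF M] by blast
  have large: "\<exists>q. prime q \<and> [q = a] (mod M) \<and> q > K" for K
    using a(2) unfolding infinite_nat_iff_unbounded by blast
  have vanish: "\<gamma> (n * q) \<in> I"
    if "n \<ge> 1" "prime q" "[q = a] (mod M)" "q > n" for n q
    using that
  proof (induction n rule: less_induct)
    case (less n)
    obtain p where p: "prime p" "[p = a] (mod M)" "p > q + N + n" using large by blast
    have ndvd: "\<not> q dvd n" "\<not> p dvd n" using less.prems p by (auto dest: dvd_imp_le)
    have "\<not> q dvd n * p"
      using less.prems p ndvd primes_dvd_imp_eq[of q p] by (auto simp: prime_dvd_mult_iff)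
    have dpos: "d \<ge> 1" if "d dvd n" for d using that less.prems by (auto intro: Suc_leI dvd_pos_nat)
    have pN: "x * p \<ge> N" if "x \<ge> 1" for x
      using that p by (metis add_leD1 add_leD2 le_trans less_imp_le mult_le_mono1 mult_1)
    have split_pq: "b (n * p * q) = (\<Sum>d | d dvd n. \<gamma> d + \<gamma> (d * p) + \<gamma> (d * q) + \<gamma> (d * q * p))"
    proof -
      have "b (n * p * q) = (\<Sum>d | d dvd n * p * q. \<gamma> d)"
        using less.prems p by (intro b) (auto simp: Suc_le_eq prime_gt_0_nat)
      also have "\<dots> = (\<Sum>d | d dvd n * p. \<gamma> d) + (\<Sum>d | d dvd n * p. \<gamma> (d * q))"
        using sum_divisors_mult_prime_power[OF less.prems(2) \<open>\<not> q dvd n * p\<close>, of \<gamma> 0] by simp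
      also have "(\<Sum>d | d dvd n * p. \<gamma> d) = (\<Sum>d | d dvd n. \<gamma> d) + (\<Sum>d | d dvd n. \<gamma> (d * p))"
        using sum_divisors_mult_prime_power[OF p(1) ndvd(2), of \<gamma> 0] by simp
      also have "(\<Sum>d | d dvd n * p. \<gamma> (d * q))
          = (\<Sum>d | d dvd n. \<gamma> (d * q)) + (\<Sum>d | d dvd n. \<gamma> (d * q * p))"
        using sum_divisors_mult_prime_power[OF p(1) ndvd(2), of "\<lambda>d. \<gamma> (d * q)" 0]
        by (simp add: mult_ac)
      finally show ?thesis by (simp add: sum.distrib algebra_simps)
    qed
    have split_pp: "b (n * p * p) = (\<Sum>d | d dvd n. \<gamma> d + \<gamma> (d * p) + \<gamma> (d * p * p))"
    proof -
      have "b (n * p * p) = (\<Sum>d | d dvd n * p * p. \<gamma> d)"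
        using less.prems p by (intro b) (auto simp: Suc_le_eq prime_gt_0_nat)
      also have "\<dots> = (\<Sum>d | d dvd n * p. \<gamma> d) + (\<Sum>d | d dvd n. \<gamma> (d * p * p))"
        using sum_divisors_mult_prime_power[OF p(1) ndvd(2), of \<gamma> 1] by (simp add: mult_ac)
      also have "(\<Sum>d | d dvd n * p. \<gamma> d) = (\<Sum>d | d dvd n. \<gamma> d) + (\<Sum>d | d dvd n. \<gamma> (d * p))"
        using sum_divisors_mult_prime_power[OF p(1) ndvd(2), of \<gamma> 0] by simp
      finally show ?thesis by (simp add: sum.distrib algebra_simps)
    qed
    have qp: "[q = p] (mod M)" using less.prems(3) p(2) by (metis cong_sym cong_trans)
    have "b (n * p * q) - b (n * p * p) \<in> I"
    proof (rule b_per)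
      show "n * p * q \<ge> N" "n * p * p \<ge> N"
        using pN[of "n * q"] pN[of "n * p"] less.prems p
        by (auto simp: mult_ac Suc_le_eq prime_gt_0_nat)
      show "[n * p * q = n * p * p] (mod M)" using qp by (intro cong_mult cong_refl)
    qed
    moreover have "(\<Sum>d | d dvd n. \<gamma> (d * q * p) - \<gamma> (d * p * p)) \<in> I"
    proof (intro sum_ideal \<gamma>_per)
      fix d assume "d \<in> {d. d dvd n}"
      then show "d * q * p \<ge> N" "d * p * p \<ge> N"
        using less.prems p dpos[of d] by (auto intro!: pN simp: Suc_le_eq prime_gt_0_nat)
      show "[d * q * p = d * p * p] (mod M)" using qp by (intro cong_mult cong_refl)
    qed
    ultimately have "b (n * p * q) - b (n * p * p)
        - (\<Sum>d | d dvd n. \<gamma> (d * q * p) - \<gamma> (d * p * p)) \<in> I"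
      by (rule diff_ideal)
    then have total: "(\<Sum>d | d dvd n. \<gamma> (d * q)) \<in> I"
      unfolding split_pq split_pp by (simp add: sum.distrib sum_subtractf algebra_simps)
    have "(\<Sum>d\<in>{d. d dvd n} - {n}. \<gamma> (d * q)) \<in> I"
    proof (rule sum_ideal)
      fix d assume "d \<in> {d. d dvd n} - {n}"
      then have "d < n" "d \<ge> 1" using less.prems dpos by (auto dest: dvd_imp_le intro: le_neq_implies_less)
      then show "\<gamma> (d * q) \<in> I" using less by simp
    qed
    then have "(\<Sum>d | d dvd n. \<gamma> (d * q)) - (\<Sum>d\<in>{d. d dvd n} - {n}. \<gamma> (d * q)) \<in> I"
      by (rule diff_ideal[OF total])
    moreover have "finite {d. d dvd n}" using less.prems by (auto intro: finite_divisors_nat)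
    ultimately show ?case by (simp add: sum.remove[of "{d. d dvd n}" n])
  qed
  obtain x where x: "[a * x = 1] (mod M)" using cong_solve_coprime_nat[OF a(1)] by auto
  \<comment> \<open>Modulo \<open>M\<close>, \<open>n\<close> is \<open>m\<close> divided by the class of the primes; adding \<open>M\<close> makes it positive.\<close>
  define n where "n = x * m + M"
  obtain q where q: "prime q" "[q = a] (mod M)" "q > n + N" using large by blast
  have "\<gamma> (n * q) \<in> I" using q M by (intro vanish) (auto simp: n_def)
  moreover have "\<gamma> m - \<gamma> (n * q) \<in> I"
  proof (rule \<gamma>_per[OF m])
    show "n * q \<ge> N" using q M mult_le_mono[of 1 n N q] by (simp add: n_def)
    have "[n * q = (x * m + 0) * a] (mod M)"
      unfolding n_def using q(2) by (intro cong_mult cong_add cong_refl) (auto simp: cong_def)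
    also have "(x * m + 0) * a = (a * x) * m" by simp
    also have "[(a * x) * m = 1 * m] (mod M)" using x by (intro cong_mult cong_refl)
    finally show "[m = n * q] (mod M)" by (simp add: cong_sym)
  qed
  ultimately show ?thesis using add_ideal by fastforce
qed

lemma recurrence_values_in_subring:
  fixes u c :: "nat \<Rightarrow> 'a::idom"
  assumes A: "subring_ideal A A" and init: "\<And>n. n < N + r \<Longrightarrow> u n \<in> A"
    and c: "\<And>j. j \<in> {1..r} \<Longrightarrow> c j \<in> A"
    and rec: "\<And>n. n \<ge> N \<Longrightarrow> u (n + r) = (\<Sum>j=1..r. c j * u (n + r - j))"
  shows "u n \<in> A"
proof -
  interpret subring_ideal A A by fact
  show ?thesis
  proof (induction n rule: less_induct)
    case (less n)
    show ?case
    proof (cases "n < N + r")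
      case False
      then have "u n = (\<Sum>j=1..r. c j * u (n - j))" using rec[of "n - r"] by simp
      moreover have "(\<Sum>j=1..r. c j * u (n - j)) \<in> A"
        using False by (intro sum_mem mult_mem c less.IH) auto
      ultimately show ?thesis by simp
    qed (rule init)
  qed
qed

section \<open>Recurrent sequences with recurrent divisor sums\<close>

theorem theorem1p1:
  fixes \<gamma> b :: "nat \<Rightarrow> complex"
  assumes "\<And>n. n \<ge> 1 \<Longrightarrow> b n = (\<Sum>d | d dvd n. \<gamma> d)"
    and "eventually_linearly_recurrent \<gamma>"
    and "eventually_linearly_recurrent b"
  shows "finite {n. n \<ge> 1 \<and> \<gamma> n \<noteq> 0}"
proof -
  obtain r c N1 where c: "r \<ge> 1" "c r \<noteq> 0"
      "\<And>n. n \<ge> N1 \<Longrightarrow> \<gamma> (n + r) = (\<Sum>j=1..r. c j * \<gamma> (n + r - j))"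
    using assms(2) unfolding eventually_linearly_recurrent_def by blast
  obtain r' c' N2 where c': "r' \<ge> 1" "c' r' \<noteq> 0"
      "\<And>n. n \<ge> N2 \<Longrightarrow> b (n + r') = (\<Sum>j=1..r'. c' j * b (n + r' - j))"
    using assms(3) unfolding eventually_linearly_recurrent_def by blast
  \<comment> \<open>The summand \<open>1\<close> keeps the index \<open>0\<close> out, where \<open>b\<close> need not be a divisor sum.\<close>
  define N where "N = N1 + N2 + 1"
  obtain A where A: "c ` {1..r} \<union> c' ` {1..r'} \<union> \<gamma> ` {..<N1 + r} \<subseteq> A"
      "detected_by_finite_quotients A"
    using finite_set_in_detected_ring[of "c ` {1..r} \<union> c' ` {1..r'} \<union> \<gamma> ` {..<N1 + r}"] by auto
  then interpret R: subring_ideal A A by (simp add: detected_by_finite_quotients_def)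
  have cA: "c j \<in> A" if "j \<in> {1..r}" for j using A(1) that by blast
  have cA': "c' j \<in> A" if "j \<in> {1..r'}" for j using A(1) that by blast
  have \<gamma>A: "\<gamma> n \<in> A" for n
    using recurrence_values_in_subring[OF R.subring_ideal_axioms, of N1 r \<gamma> c] A(1) cA c(3) by blast
  have bA: "b n \<in> A" if "n \<ge> N" for n
    using that assms(1)[of n] \<gamma>A by (auto simp: N_def intro: R.sum_mem)
  have "\<gamma> m = 0" if m: "m \<ge> N" for m
  proof (rule ccontr)
    assume "\<gamma> m \<noteq> 0"
    then have "\<gamma> m * c r * c' r' \<in> A" "\<gamma> m * c r * c' r' \<noteq> 0"
      using c c' \<gamma>A cA cA' by (auto intro!: R.mult_mem)
    then obtain I z where I: "subring_ideal A I" "finite_index I A" "1 \<notin> I"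
        and z: "z \<in> A" "\<gamma> m * c r * c' r' * z - 1 \<in> I"
      using A(2) unfolding detected_by_finite_quotients_def unit_in_finite_quotient_def by metis
    interpret subring_ideal A I by fact
    have unit: "c' r' * z * \<gamma> m \<in> A" "c r * (c' r' * z * \<gamma> m) - 1 \<in> I"
      and unit': "c r * z * \<gamma> m \<in> A" "c' r' * (c r * z * \<gamma> m) - 1 \<in> I"
      using z c(1) c'(1) \<gamma>A cA[of r] cA'[of r'] by (auto intro!: mult_mem simp: mult_ac)
    obtain M1 where M1: "M1 > 0" "\<And>n. n \<ge> N \<Longrightarrow> \<gamma> (n + M1) - \<gamma> n \<in> I"
      using recurrence_periodic_mod_ideal[where u = \<gamma> and c = c and r = r and N = N,
          OF I(2) \<gamma>A cA c(1) unit] c(3) unfolding N_def by auto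
    obtain M2 where M2: "M2 > 0" "\<And>n. n \<ge> N \<Longrightarrow> b (n + M2) - b n \<in> I"
      using recurrence_periodic_mod_ideal[where u = b and c = c' and r = r' and N = N,
          OF I(2) bA cA' c'(1) unit'] c'(3) unfolding N_def by auto
    have "\<gamma> m \<in> I"
    proof (rule periodic_divisor_sum_vanishes[OF assms(1) _ _ _ m])
      show "M1 * M2 > 0" using M1 M2 by simp
      show "\<gamma> n - \<gamma> n' \<in> I" if "n \<ge> N" "n' \<ge> N" "[n = n'] (mod M1 * M2)" for n n'
        using periodic_mod_ideal_cong[where u = \<gamma>, OF M1(2) that] .
      show "b n - b n' \<in> I" if "n \<ge> N" "n' \<ge> N" "[n = n'] (mod M1 * M2)" for n n'
        using periodic_mod_ideal_cong[where u = b and K = M1, OF M2(2) that(1,2)] that(3) by (simp add: mult.commute)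
    qed
    then have "(c r * c' r' * z) * \<gamma> m - (\<gamma> m * c r * c' r' * z - 1) \<in> I"
      by (rule diff_ideal[OF absorb[rotated] z(2)])
         (use c(1) c'(1) cA[of r] cA'[of r'] z in \<open>auto intro!: mult_mem\<close>)
    then show False using I(3) by (simp add: mult_ac)
  qed
  then have "{n. n \<ge> 1 \<and> \<gamma> n \<noteq> 0} \<subseteq> {..<N}" by (auto simp: not_less[symmetric])
  then show ?thesis by (rule finite_subset) simp
qed

end
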